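(* Let $n\geq 1$. A Riemannian metric on $\mathrm{Sym}^+(n)$ is a Lie-Cholesky metric if and only if it is $\mathrm{LT}^+(n)$-invariant.
   Context: $\mathrm{Sym}^+(n)$ is the manifold of $n\times n$ real symmetric positive definite matrices. $\mathrm{LT}^+(n)$ is the set of real $n\times n$ lower triangular matrices with positive diagonal entries; it is a Lie group for matrix multiplication (open in the vector space of lower triangular matrices). The Cholesky map $\mathrm{Chol}:\mathrm{Sym}^+(n)\to\mathrm{LT}^+(n)$ sends $\Sigma$ to the unique $L\in\mathrm{LT}^+(n)$ with $\Sigma=LL^\top$; it is a smooth diffeomorphism. A Lie-Cholesky metric on $\mathrm{Sym}^+(n)$ is the pullback, via the diffeomorphism $\mathrm{Chol}$, of a left-invariant Riemannian metric on the Lie group $(\mathrm{LT}^+(n),\times)$. A Riemannian metric $g$ on $\mathrm{Sym}^+(n)$ is $\mathrm{LT}^+(n)$-invariant if it is invariant under the congruence action $(L,\Sigma)\mapsto L\Sigma L^\top$, i.e. $g_{L\Sigma L^\top}(LVL^\top,LWL^\top)=g_\Sigma(V,W)$ for all $L\in\mathrm{LT}^+(n)$, $\Sigma\in\mathrm{Sym}^+(n)$ and symmetric matrices $V,W$. *)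

theory Defs
  imports "HOL-Analysis.Analysis"
begin

section \<open>Smooth functions and Riemannian metrics on open subsets of linear subspaces\<close>

text \<open>
  Both manifolds below are relatively open subsets \<open>U\<close> of a linear subspace \<open>T\<close> of a Euclidean
  space, so every tangent space is \<open>T\<close>. Derivatives are taken \<open>at x within U\<close>. As \<open>U\<close> is open
  in \<open>T\<close> only, such a derivative is determined on \<open>T\<close> but not on the ambient space, which is why
  only tangent directions \<open>v \<in> T\<close> occur in the following definitions.
\<close>

primrec Ck_on :: "nat \<Rightarrow> 'a::euclidean_space set \<Rightarrow> 'a set \<Rightarrow> ('a \<Rightarrow> 'b::real_normed_vector) \<Rightarrow> bool"
  where
    "Ck_on 0 T U f \<longleftrightarrow> continuous_on U f"
  | "Ck_on (Suc k) T U f \<longleftrightarrow>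
       (\<exists>D. (\<forall>x\<in>U. (f has_derivative D x) (at x within U)) \<and>
            (\<forall>v\<in>T. Ck_on k T U (\<lambda>x. D x v)))"

definition smooth_on :: "'a::euclidean_space set \<Rightarrow> 'a set \<Rightarrow> ('a \<Rightarrow> 'b::real_normed_vector) \<Rightarrow> bool"
  where "smooth_on T U f \<longleftrightarrow> (\<forall>k. Ck_on k T U f)"

text \<open>
  \<open>g x v w\<close> is the inner product of the tangent vectors \<open>v, w \<in> T\<close> at \<open>x \<in> U\<close>; the values of \<open>g\<close>
  on other arguments are irrelevant. Linearity in \<open>w\<close> follows by symmetry.
\<close>

definition riemannian_metric ::
    "'a::euclidean_space set \<Rightarrow> 'a set \<Rightarrow> ('a \<Rightarrow> 'a \<Rightarrow> 'a \<Rightarrow> real) \<Rightarrow> bool"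
  where "riemannian_metric T U g \<longleftrightarrow>
    (\<forall>x\<in>U.
       (\<forall>u\<in>T. \<forall>v\<in>T. \<forall>w\<in>T. g x (u + v) w = g x u w + g x v w) \<and>
       (\<forall>c. \<forall>v\<in>T. \<forall>w\<in>T. g x (c *\<^sub>R v) w = c * g x v w) \<and>
       (\<forall>v\<in>T. \<forall>w\<in>T. g x v w = g x w v) \<and>
       (\<forall>v\<in>T. v \<noteq> 0 \<longrightarrow> g x v v > 0)) \<and>
    (\<forall>v\<in>T. \<forall>w\<in>T. smooth_on T U (\<lambda>x. g x v w))"

definition pullback ::
    "'a::euclidean_space set \<Rightarrow> ('a \<Rightarrow> 'b::euclidean_space) \<Rightarrow> ('b \<Rightarrow> 'b \<Rightarrow> 'b \<Rightarrow> real) \<Rightarrow>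
     ('a \<Rightarrow> 'a \<Rightarrow> 'a \<Rightarrow> real)"
  where "pullback U F h x v w =
    h (F x) (frechet_derivative F (at x within U) v) (frechet_derivative F (at x within U) w)"


section \<open>Symmetric positive definite matrices and the Cholesky map\<close>

type_synonym 'n sqmat = "((real, 'n) vec, 'n) vec"

text \<open>
  The index type \<open>'n\<close> is a finite linear order, so that lower triangular matrices make sense;
  \<open>n = CARD('n) \<ge> 1\<close> is arbitrary.
\<close>

definition Sym :: "'n::finite sqmat set"
  where "Sym = {A. transpose A = A}"

definition SymPos :: "'n::finite sqmat set"
  where "SymPos = {A \<in> Sym. \<forall>x. x \<noteq> 0 \<longrightarrow> x \<bullet> (A *v x) > 0}"

definition LT :: "'n::{finite,linorder} sqmat set"
  where "LT = {A. \<forall>i j. i < j \<longrightarrow> A $ i $ j = 0}"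

definition LTPos :: "'n::{finite,linorder} sqmat set"
  where "LTPos = {A \<in> LT. \<forall>i. A $ i $ i > 0}"

definition Chol :: "'n::{finite,linorder} sqmat \<Rightarrow> 'n sqmat"
  where "Chol S = (THE L. L \<in> LTPos \<and> S = L ** transpose L)"


section \<open>Lie-Cholesky metrics and invariant metrics\<close>

definition left_invariant ::
    "('n::{finite,linorder} sqmat \<Rightarrow> 'n sqmat \<Rightarrow> 'n sqmat \<Rightarrow> real) \<Rightarrow> bool"
  where "left_invariant h \<longleftrightarrow>
    (\<forall>K\<in>LTPos. \<forall>L\<in>LTPos. \<forall>X\<in>LT. \<forall>Y\<in>LT. pullback LTPos (\<lambda>M. K ** M) h L X Y = h L X Y)"

definition lie_cholesky_metric ::
    "('n::{finite,linorder} sqmat \<Rightarrow> 'n sqmat \<Rightarrow> 'n sqmat \<Rightarrow> real) \<Rightarrow> bool"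
  where "lie_cholesky_metric g \<longleftrightarrow>
    (\<exists>h. riemannian_metric LT LTPos h \<and> left_invariant h \<and>
         (\<forall>S\<in>SymPos. \<forall>V\<in>Sym. \<forall>W\<in>Sym. g S V W = pullback SymPos Chol h S V W))"

definition LTPos_invariant ::
    "('n::{finite,linorder} sqmat \<Rightarrow> 'n sqmat \<Rightarrow> 'n sqmat \<Rightarrow> real) \<Rightarrow> bool"
  where "LTPos_invariant g \<longleftrightarrow>
    (\<forall>L\<in>LTPos. \<forall>S\<in>SymPos. \<forall>V\<in>Sym. \<forall>W\<in>Sym.
       g (L ** S ** transpose L) (L ** V ** transpose L) (L ** W ** transpose L) = g S V W)"

end

theory Submission
  imports Defs
begin

text \<open>
  Since \<open>Chol (K S K\<^sup>T) = K Chol S\<close>, the Cholesky map turns the congruence action into left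
  multiplication. Its derivative at \<open>S = L L\<^sup>T\<close> sends \<open>V\<close> to the unique lower triangular \<open>X\<close> with
  \<open>X L\<^sup>T + L X\<^sup>T = V\<close>. By uniqueness, \<open>K V K\<^sup>T\<close> at \<open>K S K\<^sup>T\<close> is sent to \<open>K X\<close>, so
  pullbacks of left-invariant metrics are invariant. Conversely, an invariant \<open>g\<close> is the pullback of
  \<open>h\<^sub>L(X, Y) = g\<^sub>I(A + A\<^sup>T, B + B\<^sup>T)\<close> with \<open>A = L\<^sup>-\<^sup>1 X\<close> and \<open>B = L\<^sup>-\<^sup>1 Y\<close>. This \<open>h\<close> is
  defined from \<open>g\<close> at the identity only, so its smoothness is that of matrix inversion, and only
  differentiability of \<open>Chol\<close> is needed.
\<close>

section \<open>Triangular matrices and the Cholesky decomposition\<close>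

lemma bounded_bilinear_matrix_mult:
  "bounded_bilinear (\<lambda>(A::real^'m^'n) (B::real^'p^'m). A ** B)"
  unfolding bilinear_conv_bounded_bilinear[symmetric] bilinear_def
  by (auto intro!: linearI simp: vec_eq_iff matrix_matrix_mult_def sum.distrib algebra_simps sum_distrib_left)

interpretation matmul: bounded_bilinear "\<lambda>(A::real^'m^'n) (B::real^'p^'m). A ** B"
  by (rule bounded_bilinear_matrix_mult)

lemma matrix_inv_inverse:
  fixes A :: "real^'n^'n"
  assumes "invertible A"
  shows "A ** matrix_inv A = mat 1" "matrix_inv A ** A = mat 1"
  using someI_ex[of "\<lambda>A'. A ** A' = mat 1 \<and> A' ** A = mat 1"] assms
  unfolding matrix_inv_def invertible_def by blast+

lemma transpose_add: "transpose (A + B) = transpose A + transpose (B::real^'m^'n)"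
  and transpose_diff: "transpose (A - B) = transpose A - transpose B"
  by (simp_all add: transpose_def vec_eq_iff)

lemma subspace_Sym: "subspace Sym"
  by (auto simp: subspace_def Sym_def transpose_add transpose_scalar) (simp add: transpose_def vec_eq_iff)

lemma subspace_LT: "subspace LT"
  by (auto simp: subspace_def LT_def)

lemma congruence_Sym: "A ** V ** transpose A \<in> Sym" if "V \<in> Sym"
  using that by (simp add: Sym_def matrix_transpose_mul matrix_mul_assoc)

lemma gram_Sym: "A ** transpose A \<in> Sym"
  by (simp add: Sym_def matrix_transpose_mul)

lemma add_transpose_Sym: "A + transpose A \<in> Sym"
  by (simp add: Sym_def transpose_add add.commute)

lemma inner_congruence:
  fixes A S :: "real^'n^'n"
  shows "x \<bullet> ((A ** S ** transpose A) *v x) = (transpose A *v x) \<bullet> (S *v (transpose A *v x))"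
  by (simp only: matrix_vector_mul_assoc[symmetric] transpose_matrix_vector dot_lmul_matrix)

lemma congruence_SymPos:
  fixes A S :: "'n::finite sqmat"
  assumes S: "S \<in> SymPos" and A: "invertible A"
  shows "A ** S ** transpose A \<in> SymPos"
proof -
  obtain B where "B ** transpose A = mat 1"
    using transpose_invertible[OF A] unfolding invertible_def by auto
  then have "transpose A *v x \<noteq> 0" if "x \<noteq> 0" for x
    using that matrix_left_invertible_ker[of "transpose A"] by metis
  then have "x \<bullet> ((A ** S ** transpose A) *v x) > 0" if "x \<noteq> 0" for x
    using that S unfolding inner_congruence SymPos_def by (simp del: transpose_matrix_vector)
  moreover have "A ** S ** transpose A \<in> Sym"
    using S by (intro congruence_Sym) (simp add: SymPos_def)
  ultimately show ?thesis by (simp add: SymPos_def)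
qed

lemma mat_1_SymPos: "mat 1 \<in> SymPos"
  by (simp add: SymPos_def Sym_def)

section \<open>The group of lower triangular matrices with positive diagonal\<close>

lemma LTPos_LT: "L \<in> LTPos \<Longrightarrow> L \<in> LT"
  by (simp add: LTPos_def)

lemma LT_mult: "A ** B \<in> LT" if "A \<in> LT" "B \<in> LT"
proof -
  \<comment> \<open>Either \<open>i < k\<close>, which kills the entry of \<open>A\<close>, or
    \<open>k \<le> i < j\<close>, which kills the entry of \<open>B\<close>.\<close>
  have "A $ i $ k * B $ k $ j = 0" if "i < j" for i j k
    using \<open>A \<in> LT\<close> \<open>B \<in> LT\<close> that by (cases "i < k") (auto simp: LT_def not_less dest: le_less_trans)
  then show ?thesis by (auto simp: LT_def matrix_matrix_mult_def intro!: sum.neutral)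
qed

lemma LT_mult_diag: "(A ** B) $ i $ i = A $ i $ i * B $ i $ i" if "A \<in> LT" "B \<in> LT"
proof -
  have "(\<Sum>k\<in>UNIV. A $ i $ k * B $ k $ i) = (\<Sum>k\<in>{i}. A $ i $ k * B $ k $ i)"
    using that by (intro sum.mono_neutral_right) (auto simp: LT_def neq_iff)
  then show ?thesis by (simp add: matrix_matrix_mult_def)
qed

lemma LTPos_mult: "A ** B \<in> LTPos" if "A \<in> LTPos" "B \<in> LTPos"
  using that by (auto simp: LTPos_def LT_mult LT_mult_diag)

text \<open>Row \<open>i\<close> of \<open>L *v x\<close> involves only the coordinates up to
  \<open>i\<close>, with a positive coefficient at \<open>i\<close>. The cut-off \<open>j\<close>
  lets the lemma treat columns of an inverse as well as kernel vectors.\<close>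

lemma forward_substitution:
  fixes j :: "'n::{finite,linorder}"
  assumes L: "L \<in> LTPos" and 0: "\<And>i. i < j \<Longrightarrow> (L *v x) $ i = 0"
  shows "i < j \<Longrightarrow> x $ i = 0"
\<comment> \<open>The number of smaller indices is the position of \<open>i\<close> in the finite
  order, so this is strong induction along that order.\<close>
proof (induction i rule: measure_induct_rule[where f = "\<lambda>i. card {..<i}"])
  case (less i)
  have "x $ k = 0" if "k < i" for k
    using that less by (auto intro!: less.IH psubset_card_mono)
  then have "(\<Sum>k\<in>UNIV. L $ i $ k * x $ k) = (\<Sum>k\<in>{i}. L $ i $ k * x $ k)"
    using L by (intro sum.mono_neutral_right) (auto simp: LTPos_def LT_def neq_iff)
  then have "L $ i $ i * x $ i = 0"
    using 0[OF less.prems] by (simp add: matrix_vector_mult_def)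
  moreover have "L $ i $ i > 0" using L by (simp add: LTPos_def)
  ultimately show ?case by simp
qed

lemma LTPos_invertible:
  fixes L :: "'n::{finite,linorder} sqmat"
  assumes "L \<in> LTPos"
  shows "invertible L"
proof -
  have "x = 0" if x: "L *v x = 0" for x
  proof -
    \<comment> \<open>\<open>forward_substitution\<close> reaches only indices strictly below its
      bound, so the last coordinate is read off from the last row separately.\<close>
    let ?m = "Max UNIV :: 'n"
    have *: "x $ i = 0" if "i < ?m" for i
      using forward_substitution[OF assms _ that] x by simp
    then have "(\<Sum>k\<in>UNIV. L $ ?m $ k * x $ k) = (\<Sum>k\<in>{?m}. L $ ?m $ k * x $ k)"
      by (intro sum.mono_neutral_right) (auto intro!: * order.not_eq_order_implies_strict)
    then have "L $ ?m $ ?m * x $ ?m = 0"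
      using x by (simp add: matrix_vector_mult_def vec_eq_iff)
    moreover have "L $ ?m $ ?m > 0" using assms by (simp add: LTPos_def)
    ultimately have "x $ ?m = 0" by simp
    with * show ?thesis
      unfolding vec_eq_iff by (metis Max_ge UNIV_I finite order.not_eq_order_implies_strict zero_index)
  qed
  then show ?thesis
    by (metis invertible_left_inverse matrix_left_invertible_ker)
qed

text \<open>Column \<open>j\<close> of the inverse solves \<open>L *v x = axis j 1\<close>, whose
  right-hand side vanishes before \<open>j\<close>; forward substitution gives triangularity. The
  diagonal entries are reciprocals of those of \<open>L\<close>.\<close>

lemma LTPos_inv:
  assumes "L \<in> LTPos"
  shows "matrix_inv L \<in> LTPos"
proof -
  let ?K = "matrix_inv L"
  have LK: "L ** ?K = mat 1"
    using matrix_inv_inverse LTPos_invertible assms by blast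
  have "column j ?K $ i = 0" if "i < j" for i j
  proof (rule forward_substitution[OF assms _ that])
    fix k assume "k < j"
    have "(L *v column j ?K) $ k = (L ** ?K) $ k $ j"
      by (simp add: matrix_vector_mult_def matrix_matrix_mult_def column_def)
    then show "(L *v column j ?K) $ k = 0"
      using \<open>k < j\<close> by (simp add: LK mat_def)
  qed
  then have K: "?K \<in> LT" by (simp add: LT_def column_def)
  have "L $ i $ i * ?K $ i $ i = 1" for i
    using LT_mult_diag[OF LTPos_LT[OF assms] K, of i] by (simp add: LK mat_def)
  moreover have "L $ i $ i > 0" for i using assms by (simp add: LTPos_def)
  ultimately have "?K $ i $ i > 0" for i
    by (metis zero_less_mult_pos zero_less_one)
  with K show ?thesis by (simp add: LTPos_def)
qed

lemma LTPos_gram_SymPos: "L ** transpose L \<in> SymPos" if "L \<in> LTPos"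
  using congruence_SymPos[OF mat_1_SymPos LTPos_invertible[OF that]] by simp

section \<open>Uniqueness of the Cholesky factor\<close>

lemma LT_transpose_diag:
  assumes "K \<in> LT" "transpose K \<in> LT" "i \<noteq> j"
  shows "K $ i $ j = 0"
  using assms by (auto simp: LT_def transpose_def neq_iff)

text \<open>The transpose is the inverse, hence lower triangular, so \<open>K\<close> is diagonal
  with positive entries of square 1.\<close>

lemma LTPos_orthogonal:
  assumes K: "K \<in> LTPos" and KK: "K ** transpose K = mat 1"
  shows "K = mat 1"
proof -
  have inv: "matrix_inv K ** K = mat 1" using K LTPos_invertible matrix_inv_inverse by blast
  have "transpose K = matrix_inv K ** (K ** transpose K)"
    by (simp add: matrix_mul_assoc inv)
  then have T: "transpose K \<in> LT" using KK LTPos_inv[OF K] by (simp add: LTPos_LT)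
  have "K $ i $ i * K $ i $ i = 1" for i
    using LT_mult_diag[OF LTPos_LT[OF K] T, of i, unfolded KK] by (simp add: mat_def transpose_def)
  moreover have "K $ i $ i > 0" for i using K by (simp add: LTPos_def)
  ultimately have "K $ i $ i = 1" for i
    by (metis abs_of_pos abs_1 abs_square_eq_1 power2_eq_square)
  with LT_transpose_diag[OF LTPos_LT[OF K] T] show ?thesis
    by (simp add: vec_eq_iff mat_def)
qed

text \<open>The quotient \<open>matrix_inv M ** L\<close> lies in \<open>LTPos\<close> and is
  orthogonal, so it is the identity.\<close>

lemma Cholesky_unique:
  assumes L: "L \<in> LTPos" and M: "M \<in> LTPos" and eq: "L ** transpose L = M ** transpose M"
  shows "L = M"
proof -
  let ?N = "matrix_inv M"
  have N: "M ** ?N = mat 1" "?N ** M = mat 1"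
    using M LTPos_invertible matrix_inv_inverse by blast+
  have "(?N ** L) ** transpose (?N ** L) = ?N ** (L ** transpose L) ** transpose ?N"
    by (simp add: matrix_transpose_mul matrix_mul_assoc)
  also have "\<dots> = (?N ** M) ** transpose (?N ** M)"
    by (simp add: eq matrix_transpose_mul matrix_mul_assoc)
  finally have "?N ** L = mat 1"
    using N LTPos_orthogonal LTPos_mult[OF LTPos_inv[OF M] L] by simp
  then have "M ** (?N ** L) = M" by simp
  then show ?thesis by (simp add: matrix_mul_assoc N)
qed

section \<open>Existence of the Cholesky factor\<close>

lemma SymPos_diag_pos:
  assumes "S \<in> SymPos"
  shows "S $ i $ i > 0"
proof -
  have "axis i 1 \<bullet> (S *v axis i 1) > 0"
    using assms by (auto simp: SymPos_def axis_eq_0_iff)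
  then show ?thesis
    by (simp add: matrix_vector_mult_basis inner_axis' column_def)
qed

text \<open>
  Gaussian elimination: \<open>A\<close> is the set of indices whose rows may still have off-diagonal entries,
  and its least element is the next pivot.
\<close>

lemma Cholesky_exists_supported:
  fixes A :: "'n::{finite,linorder} set"
  assumes "S \<in> SymPos" "\<And>i j. i \<notin> A \<Longrightarrow> i \<noteq> j \<Longrightarrow> S $ i $ j = 0"
  shows "\<exists>L\<in>LTPos. S = L ** transpose L"
  using assms
proof (induction "card A" arbitrary: A S)
  case 0
  \<comment> \<open>With \<open>A\<close> empty, \<open>S\<close> is diagonal and its entrywise
    square root is a factor.\<close>
  let ?L = "\<chi> i j. if i = j then sqrt (S $ i $ i) else 0"
  have "?L \<in> LTPos" using SymPos_diag_pos[OF 0(2)] by (simp add: LTPos_def LT_def)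
  moreover have "(?L ** transpose ?L) $ i $ j = S $ i $ j" for i j
  proof -
    have "(?L ** transpose ?L) $ i $ j = (if i = j then S $ i $ i else 0)"
      using SymPos_diag_pos[OF 0(2), of i]
      by (auto simp: matrix_matrix_mult_def transpose_def if_distrib[of "\<lambda>x. x * _"] cong: if_cong)
    also have "\<dots> = S $ i $ j" using 0 by auto
    finally show ?thesis .
  qed
  then have "S = ?L ** transpose ?L" unfolding vec_eq_iff by (intro allI) (rule sym)
  ultimately show ?case by blast
next
  case (Suc n)
  have "A \<noteq> {}" using Suc.hyps(2) by auto
  define m where "m = Min A"
  have m: "m \<in> A" "\<And>i. i \<in> A \<Longrightarrow> m \<le> i" using \<open>A \<noteq> {}\<close> by (simp_all add: m_def)
  have Smm: "S $ m $ m > 0" using SymPos_diag_pos Suc.prems by blast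
  have Ssym: "S $ i $ j = S $ j $ i" for i j
    using Suc.prems(1) by (auto simp: SymPos_def Sym_def transpose_def vec_eq_iff)
  \<comment> \<open>Multiplication by \<open>E\<close> on the left subtracts
    \<open>S $ i $ m / S $ m $ m\<close> times row \<open>m\<close> from each other row
    \<open>i\<close>.\<close>
  define E :: "'n sqmat" where
    "E = (\<chi> i j. (if i = j then 1 else 0) + (if j = m then (if i = m then 0 else - S $ i $ m / S $ m $ m) else 0))"
  \<comment> \<open>An index before the pivot \<open>m = Min A\<close> lies outside
    \<open>A\<close>, so its entry in column \<open>m\<close> is already zero and \<open>E\<close>
    has nothing above the diagonal.\<close>
  have "E $ i $ j = 0" if "i < j" for i j
    using that m(2)[of i] Suc.prems(2)[of i m] by (cases "i \<in> A") (auto simp: E_def)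
  then have E: "E \<in> LTPos" by (auto simp: LTPos_def LT_def E_def)
  have ES: "(E ** B) $ i $ j = B $ i $ j + (if i = m then 0 else - S $ i $ m / S $ m $ m * B $ m $ j)"
    for B :: "'n sqmat" and i j
    by (simp add: E_def matrix_matrix_mult_def distrib_right sum.distrib if_distrib[of "\<lambda>x. x * _"] cong: if_cong)
  have BE: "(B ** transpose E) $ i $ j = B $ i $ j + (if j = m then 0 else - S $ j $ m / S $ m $ m * B $ i $ m)"
    for B :: "'n sqmat" and i j
    by (simp add: E_def transpose_def matrix_matrix_mult_def distrib_left sum.distrib
        if_distrib[of "\<lambda>x. _ * x"] cong: if_cong)
  define S' where "S' = E ** S ** transpose E"
  have S': "S' \<in> SymPos"
    unfolding S'_def by (intro congruence_SymPos LTPos_invertible E Suc.prems)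
  have entry: "S' $ i $ j = S $ i $ j + (if i = m then 0 else - S $ i $ m / S $ m $ m * S $ m $ j)
      + (if j = m then 0 else - S $ j $ m / S $ m $ m *
          (S $ i $ m + (if i = m then 0 else - S $ i $ m / S $ m $ m * S $ m $ m)))" for i j
    unfolding S'_def BE ES ..
  \<comment> \<open>Row \<open>m\<close> is cleared by the column operations, using symmetry of
    \<open>S\<close>; a row outside \<open>A\<close> has a zero entry in column \<open>m\<close>, so
    elimination does not disturb it.\<close>
  have zero: "S' $ i $ j = 0" if "i \<notin> A - {m}" "i \<noteq> j" for i j
  proof (cases "i = m")
    case True
    then show ?thesis using that Smm Ssym[of m j] unfolding entry by simp
  next
    case False
    then have "S $ i $ j = 0" "S $ i $ m = 0" using that Suc.prems(2) by blast+
    with False show ?thesis unfolding entry by simp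
  qed
  have card: "n = card (A - {m})"
    using Suc.hyps(2) m(1) by (metis card_Diff_singleton diff_Suc_1)
  obtain L where L: "L \<in> LTPos" "S' = L ** transpose L"
    using Suc.hyps(1)[OF card S' zero] ..
  let ?F = "matrix_inv E"
  have F: "?F ** E = mat 1" "?F \<in> LTPos"
    by (rule matrix_inv_inverse LTPos_invertible LTPos_inv E)+
  \<comment> \<open>Undoing the elimination turns a factor \<open>L\<close> of \<open>S'\<close>
    into the factor \<open>?F ** L\<close> of \<open>S\<close>.\<close>
  have "S = (?F ** E) ** S ** transpose (?F ** E)" by (simp add: F)
  also have "\<dots> = ?F ** S' ** transpose ?F"
    by (simp only: S'_def matrix_transpose_mul matrix_mul_assoc)
  also have "\<dots> = (?F ** L) ** transpose (?F ** L)"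
    by (simp only: L matrix_transpose_mul matrix_mul_assoc)
  finally show ?case using LTPos_mult[OF F(2) L(1)] by blast
qed

section \<open>The Cholesky map and its linearized equation\<close>

lemma Chol_LTPos: "S \<in> SymPos \<Longrightarrow> Chol S \<in> LTPos"
  and Chol_gram: "S \<in> SymPos \<Longrightarrow> Chol S ** transpose (Chol S) = S"
proof -
  assume S: "S \<in> SymPos"
  obtain L where "L \<in> LTPos" "S = L ** transpose L"
    \<comment> \<open>For \<open>A = UNIV\<close> the support condition is vacuous.\<close>
    using Cholesky_exists_supported[OF S, of UNIV] by auto
  then have "\<exists>!L. L \<in> LTPos \<and> S = L ** transpose L" using Cholesky_unique by metis
  from theI'[OF this] show "Chol S \<in> LTPos" "Chol S ** transpose (Chol S) = S"
    by (auto simp: Chol_def)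
qed

lemma Chol_eqI:
  assumes "L \<in> LTPos" "S = L ** transpose L"
  shows "Chol S = L"
proof (rule Cholesky_unique)
  have "S \<in> SymPos" unfolding assms(2) by (rule LTPos_gram_SymPos[OF assms(1)])
  then show "Chol S \<in> LTPos" "Chol S ** transpose (Chol S) = L ** transpose L"
    by (simp_all only: Chol_LTPos Chol_gram flip: assms(2))
qed (rule assms)

lemma Chol_congruence:
  assumes "S \<in> SymPos" "K \<in> LTPos"
  shows "Chol (K ** S ** transpose K) = K ** Chol S"
proof (rule Chol_eqI)
  show "K ** Chol S \<in> LTPos" by (intro LTPos_mult Chol_LTPos assms)
  have "(K ** Chol S) ** transpose (K ** Chol S) = K ** (Chol S ** transpose (Chol S)) ** transpose K"
    by (simp only: matrix_transpose_mul matrix_mul_assoc)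
  then show "K ** S ** transpose K = (K ** Chol S) ** transpose (K ** Chol S)"
    by (simp only: Chol_gram[OF assms(1)])
qed

text \<open>Of two mirrored off-diagonal entries, triangularity kills one and skewness then the
  other; a diagonal entry equals its own negative.\<close>

lemma LT_skew_eq_0:
  fixes Z :: "'n::{finite,linorder} sqmat"
  assumes "Z \<in> LT" "Z + transpose Z = 0"
  shows "Z = 0"
proof -
  have *: "Z $ i $ j + Z $ j $ i = 0" for i j
    using assms(2) by (simp add: vec_eq_iff transpose_def)
  have "Z $ i $ j = 0" for i j
    using assms(1) *[of i j] by (cases i j rule: linorder_cases) (auto simp: LT_def)
  then show ?thesis by (simp add: vec_eq_iff)
qed

text \<open>Congruence by the inverse of \<open>L\<close> moves the derivative of
  \<open>L ** transpose L\<close> to the identity, where the direction becomes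
  \<open>matrix_inv L ** X\<close>.\<close>

lemma gram_derivative_inv:
  fixes L X :: "'n::{finite,linorder} sqmat"
  assumes "L \<in> LTPos"
  shows "matrix_inv L ** (X ** transpose L + L ** transpose X) ** transpose (matrix_inv L)
    = matrix_inv L ** X + transpose (matrix_inv L ** X)"
proof -
  let ?N = "matrix_inv L"
  have N: "?N ** L = mat 1" using assms LTPos_invertible matrix_inv_inverse by blast
  have "?N ** (X ** transpose L + L ** transpose X) ** transpose ?N
    = (?N ** X) ** transpose (?N ** L) + (?N ** L) ** transpose (?N ** X)"
    by (simp only: matmul.add_left matmul.add_right matrix_transpose_mul matrix_mul_assoc)
  then show ?thesis by (simp add: N)
qed

lemma gram_derivative_inj:
  fixes L X :: "'n::{finite,linorder} sqmat"
  assumes L: "L \<in> LTPos" and X: "X \<in> LT" and eq: "X ** transpose L + L ** transpose X = 0"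
  shows "X = 0"
proof -
  have "matrix_inv L ** X + transpose (matrix_inv L ** X) = 0"
    unfolding gram_derivative_inv[OF L, symmetric] eq by (simp add: matmul.zero_left matmul.zero_right)
  then have "matrix_inv L ** X = 0"
    using LT_skew_eq_0 LT_mult[OF LTPos_LT[OF LTPos_inv[OF L]] X] by blast
  then have "L ** (matrix_inv L ** X) = 0" by (simp add: matmul.zero_right)
  then show ?thesis
    by (simp add: matrix_mul_assoc matrix_inv_inverse LTPos_invertible L)
qed


section \<open>Smoothness of matrix inversion\<close>

lemma Ck_on_SucI:
  assumes "\<And>x. x \<in> U \<Longrightarrow> (f has_derivative D x) (at x within U)"
    and "\<And>v. v \<in> T \<Longrightarrow> Ck_on k T U (\<lambda>x. D x v)"
  shows "Ck_on (Suc k) T U f"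
  using assms by auto

lemma Ck_on_SucE:
  assumes "Ck_on (Suc k) T U f"
  obtains D where "\<And>x. x \<in> U \<Longrightarrow> (f has_derivative D x) (at x within U)"
    and "\<And>v. v \<in> T \<Longrightarrow> Ck_on k T U (\<lambda>x. D x v)"
  using assms by auto

lemma Ck_on_const: "Ck_on k T U (\<lambda>_. c)"
proof (induction k arbitrary: c)
  case (Suc k)
  show ?case by (rule Ck_on_SucI[where D = "\<lambda>_ _. 0"]) (auto intro: Suc)
qed simp

lemma Ck_on_Suc_imp_Ck_on: "Ck_on (Suc k) T U f \<Longrightarrow> Ck_on k T U f"
proof (induction k arbitrary: f)
  case 0
  then show ?case by (auto intro: has_derivative_continuous_on)
next
  case (Suc k)
  from Suc.prems obtain D where "\<And>x. x \<in> U \<Longrightarrow> (f has_derivative D x) (at x within U)"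
    and "\<And>v. v \<in> T \<Longrightarrow> Ck_on (Suc k) T U (\<lambda>x. D x v)"
    by (rule Ck_on_SucE) blast
  then show ?case by (rule Ck_on_SucI[OF _ Suc.IH])
qed

lemma Ck_on_add:
  "Ck_on k T U f \<Longrightarrow> Ck_on k T U g \<Longrightarrow> Ck_on k T U (\<lambda>x. f x + g x)"
proof (induction k arbitrary: f g)
  case 0
  then show ?case by (auto intro: continuous_on_add)
next
  case (Suc k)
  obtain D where D: "\<And>x. x \<in> U \<Longrightarrow> (f has_derivative D x) (at x within U)"
    "\<And>v. v \<in> T \<Longrightarrow> Ck_on k T U (\<lambda>x. D x v)"
    using Suc.prems(1) by (rule Ck_on_SucE) blast
  obtain E where E: "\<And>x. x \<in> U \<Longrightarrow> (g has_derivative E x) (at x within U)"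
    "\<And>v. v \<in> T \<Longrightarrow> Ck_on k T U (\<lambda>x. E x v)"
    using Suc.prems(2) by (rule Ck_on_SucE) blast
  show ?case
    by (rule Ck_on_SucI[OF has_derivative_add[OF D(1) E(1)] Suc.IH[OF D(2) E(2)]])
qed

lemma Ck_on_bounded_bilinear:
  assumes "bounded_bilinear B"
  shows "Ck_on k T U f \<Longrightarrow> Ck_on k T U g \<Longrightarrow> Ck_on k T U (\<lambda>x. B (f x) (g x))"
proof (induction k arbitrary: f g)
  case 0
  then show ?case by (auto intro: bounded_bilinear.continuous_on[OF assms])
next
  case (Suc k)
  obtain D where D: "\<And>x. x \<in> U \<Longrightarrow> (f has_derivative D x) (at x within U)"
    "\<And>v. v \<in> T \<Longrightarrow> Ck_on k T U (\<lambda>x. D x v)"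
    using Suc.prems(1) by (rule Ck_on_SucE) blast
  obtain E where E: "\<And>x. x \<in> U \<Longrightarrow> (g has_derivative E x) (at x within U)"
    "\<And>v. v \<in> T \<Longrightarrow> Ck_on k T U (\<lambda>x. E x v)"
    using Suc.prems(2) by (rule Ck_on_SucE) blast
  \<comment> \<open>The product rule contains \<open>f\<close> and \<open>g\<close>
    undifferentiated, so both are lowered to order \<open>k\<close> before the induction hypothesis
    applies.\<close>
  note fg = Suc.prems[THEN Ck_on_Suc_imp_Ck_on]
  show ?case
    by (rule Ck_on_SucI[OF bounded_bilinear.FDERIV[OF assms D(1) E(1)]
        Ck_on_add[OF Suc.IH[OF fg(1) E(2)] Suc.IH[OF D(2) fg(2)]]])
qed

section \<open>Inversion: continuity, derivative, smoothness\<close>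

lemma continuous_on_det:
  fixes f :: "'a::topological_space \<Rightarrow> real^'n^'n"
  assumes "continuous_on U f"
  shows "continuous_on U (\<lambda>x. det (f x))"
  unfolding det_def using assms by (intro continuous_intros)

text \<open>By Cramer's rule each entry of the inverse is a quotient of determinants:
  \<open>?C A k j\<close> is coordinate \<open>k\<close> of the solution of
  \<open>A *v x = axis j 1\<close>.\<close>

lemma continuous_on_matrix_inv: "continuous_on {A :: real^'n^'n. invertible A} matrix_inv"
proof -
  let ?I = "{A :: real^'n^'n. invertible A}"
  let ?C = "\<lambda>(A::real^'n^'n) k j. det (\<chi> i l. if l = k then axis j 1 $ i else A $ i $ l) / det A"
  have eq: "matrix_inv A = (\<chi> k j. ?C A k j)" if "invertible A" for A :: "real^'n^'n"
  proof -
    have "A *v (matrix_inv A *v axis j 1) = axis j 1" for j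
      using matrix_inv_inverse(1)[OF that] by (simp add: matrix_vector_mul_assoc)
    moreover have "det A \<noteq> 0" using that by (simp add: invertible_det_nz)
    ultimately have "matrix_inv A *v axis j 1 = (\<chi> k. ?C A k j)" for j
      by (intro cramer[THEN iffD1])
    then have "(matrix_inv A *v axis j 1) $ k = ?C A k j" for k j
      by simp
    then show ?thesis by (simp add: matrix_vector_mult_basis column_def vec_eq_iff)
  qed
  have cont: "continuous_on ?I (\<lambda>A. \<chi> k j. ?C A k j)"
  proof (intro continuous_on_vec_lambda continuous_on_divide continuous_on_det continuous_on_id ballI)
    fix k j i l :: 'n
    show "continuous_on ?I (\<lambda>A. if l = k then axis j 1 $ i else A $ i $ l)"
      by (cases "l = k") (auto intro!: continuous_intros)
  qed (simp add: invertible_det_nz)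
  show ?thesis by (rule continuous_on_eq[OF cont]) (simp add: eq)
qed

lemma has_derivative_matrix_inv:
  fixes A :: "real^'n^'n"
  assumes U: "U \<subseteq> {A. invertible A}" and A: "A \<in> U"
  shows "(matrix_inv has_derivative (\<lambda>V. - (matrix_inv A ** V ** matrix_inv A))) (at A within U)"
proof -
  let ?N = "matrix_inv :: real^'n^'n \<Rightarrow> real^'n^'n"
  obtain K where K: "\<And>X Y. norm ((X::real^'n^'n) ** (Y::real^'n^'n)) \<le> norm X * norm Y * K" "K > 0"
    using matmul.pos_bounded by metis
  \<comment> \<open>The first-order remainder factors exactly through \<open>?N A - ?N B\<close> and
    \<open>B - A\<close>, so continuity of inversion makes it small compared with
    \<open>B - A\<close>.\<close>
  have eq: "?N B - ?N A - - (?N A ** (B - A) ** ?N A) = (?N A - ?N B) ** ((B - A) ** ?N A)" if "B \<in> U" for B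
  proof -
    have "invertible A" "invertible B" using that A U by auto
    then have "A ** ?N A = mat 1" "?N B ** B = mat 1" by (simp_all add: matrix_inv_inverse)
    then have "?N B ** ((B - A) ** ?N A) = ?N A - ?N B"
      by (simp add: matmul.diff_left matmul.diff_right matrix_mul_assoc)
    then show ?thesis
      unfolding matmul.diff_left[of "?N A" "?N B"] by (simp add: matrix_mul_assoc)
  qed
  have "bounded_linear (\<lambda>V. - (?N A ** V ** ?N A))"
    by (intro bounded_linear_minus
        bounded_linear_compose[OF matmul.bounded_linear_left matmul.bounded_linear_right])
  moreover have "((\<lambda>B. norm (?N B - ?N A - - (?N A ** (B - A) ** ?N A)) / norm (B - A)) \<longlongrightarrow> 0) (at A within U)"
  proof (rule Lim_null_comparison)
    have "norm (norm (?N B - ?N A - - (?N A ** (B - A) ** ?N A)) / norm (B - A)) \<le> norm (?N A - ?N B) * (norm (?N A) * K * K)"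
      if "B \<in> U" for B
    proof -
      have "norm ((?N A - ?N B) ** ((B - A) ** ?N A)) \<le> norm (?N A - ?N B) * (norm (B - A) * norm (?N A) * K) * K"
        using K order.trans[OF K(1)] by (simp add: mult_left_mono mult_right_mono)
      then show ?thesis unfolding eq[OF that]
        by (cases "B = A") (auto simp: divide_le_eq mult_ac)
    qed
    then show "\<forall>\<^sub>F B in at A within U. norm (norm (?N B - ?N A - - (?N A ** (B - A) ** ?N A)) / norm (B - A))
        \<le> norm (?N A - ?N B) * (norm (?N A) * K * K)"
      by (simp add: eventually_at_filter)
    have "(?N \<longlongrightarrow> ?N A) (at A within U)"
      using continuous_on_subset[OF continuous_on_matrix_inv U] A by (simp add: continuous_on_def)
    then have "((\<lambda>B. norm (?N A - ?N B) * (norm (?N A) * K * K)) \<longlongrightarrow> norm (?N A - ?N A) * (norm (?N A) * K * K)) (at A within U)"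
      by (intro tendsto_intros)
    then show "((\<lambda>B. norm (?N A - ?N B) * (norm (?N A) * K * K)) \<longlongrightarrow> 0) (at A within U)" by simp
  qed
  ultimately show ?thesis
    by (simp add: has_derivative_iff_norm)
qed

text \<open>The derivative is a product of constants and the inverse itself, so regularity
  bootstraps.\<close>

lemma Ck_on_matrix_inv:
  fixes U :: "(real^'n^'n) set"
  assumes "U \<subseteq> {A. invertible A}"
  shows "Ck_on k T U matrix_inv"
proof (induction k)
  case 0
  show ?case using continuous_on_subset[OF continuous_on_matrix_inv assms] by simp
next
  case (Suc k)
  \<comment> \<open>The factor \<open>- mat 1\<close> turns the sign into one more matrix
    product.\<close>
  have "Ck_on k T U (\<lambda>A. - mat 1 ** (matrix_inv A ** V ** matrix_inv A))" for V
    by (intro Ck_on_bounded_bilinear[OF bounded_bilinear_matrix_mult] Ck_on_const Suc)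
  then show ?case
    by (intro Ck_on_SucI[OF has_derivative_matrix_inv[OF assms]]) (simp_all add: matmul.minus_left)
qed

section \<open>Derivatives within relatively open sets\<close>

text \<open>Along the line \<open>x + t *\<^sub>R v\<close>, which stays in \<open>U\<close> for
  small \<open>t\<close>, both derivatives yield an ordinary vector derivative at 0, which is
  unique.\<close>

lemma has_derivative_unique_rel_open:
  fixes f :: "'a::euclidean_space \<Rightarrow> 'b::euclidean_space"
  assumes D: "(f has_derivative D) (at x within U)" "(f has_derivative D') (at x within U)"
    and O: "open O'" "x \<in> O'" "O' \<inter> T \<subseteq> U" and T: "subspace T" "x \<in> T" "v \<in> T"
  shows "D v = D' v"
proof -
  let ?\<gamma> = "\<lambda>t::real. x + t *\<^sub>R v"
  let ?S = "?\<gamma> -` O'"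
  have S: "open ?S" "0 \<in> ?S"
    using O by (auto intro!: open_vimage continuous_intros)
  have "?\<gamma> ` ?S \<subseteq> U"
    using O T by (auto simp: subspace_def)
  then have *: "((\<lambda>t. f (?\<gamma> t)) has_vector_derivative E v) (at 0)"
    if "(f has_derivative E) (at x within U)" for E
  proof -
    have "(?\<gamma> has_derivative (\<lambda>t. t *\<^sub>R v)) (at 0 within ?S)"
      by (auto intro!: derivative_eq_intros)
    moreover have "(f has_derivative E) (at (?\<gamma> 0) within ?\<gamma> ` ?S)"
      using has_derivative_subset[OF that \<open>?\<gamma> ` ?S \<subseteq> U\<close>] by simp
    ultimately have "(f \<circ> ?\<gamma> has_derivative E \<circ> (\<lambda>t. t *\<^sub>R v)) (at 0 within ?S)"
      by (rule diff_chain_within)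
    moreover have "E (t *\<^sub>R v) = t *\<^sub>R E v" for t
      using that by (simp add: has_derivative_def bounded_linear.linear linear_scale)
    ultimately show ?thesis
      by (simp only: has_vector_derivative_def o_def at_within_open[OF S(2) S(1)])
  qed
  show ?thesis
    using vector_derivative_unique_at[OF *[OF D(1)] *[OF D(2)]] .
qed

text \<open>\<open>frechet_derivative\<close> is a choice among the derivatives within
  \<open>U\<close>; in directions from \<open>T\<close> all choices agree.\<close>

lemma frechet_derivative_rel_open:
  fixes f :: "'a::euclidean_space \<Rightarrow> 'b::euclidean_space"
  assumes D: "(f has_derivative D) (at x within U)"
    and O: "open O'" "x \<in> O'" "O' \<inter> T \<subseteq> U" and T: "subspace T" "x \<in> T" "v \<in> T"
  shows "frechet_derivative f (at x within U) v = D v"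
  using has_derivative_unique_rel_open[OF _ D O T] D frechet_derivative_works differentiableI by blast


section \<open>The derivative of the Cholesky map\<close>

definition lower_part :: "'n::{finite,linorder} sqmat \<Rightarrow> 'n sqmat"
  where "lower_part A = (\<chi> i j. if j \<le> i then A $ i $ j else 0)"

definition upper_part :: "'n::{finite,linorder} sqmat \<Rightarrow> 'n sqmat"
  where "upper_part A = (\<chi> i j. if i < j then A $ i $ j else 0)"

text \<open>
  The map \<open>L \<mapsto> L L\<^sup>T\<close> extended from lower triangular matrices to all matrices, so that the inverse
  function theorem and invariance of domain for Euclidean spaces apply: the strictly upper
  triangular part of the argument becomes the skew-symmetric part of the value.
\<close>

definition gram_ext :: "'n::{finite,linorder} sqmat \<Rightarrow> 'n sqmat"
  where "gram_ext A = lower_part A ** transpose (lower_part A)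
    + (upper_part A - transpose (upper_part A))"

text \<open>An open set of the full matrix space that meets \<open>LT\<close> exactly in
  \<open>LTPos\<close>.\<close>

definition diag_pos :: "'n::finite sqmat set"
  where "diag_pos = {A. \<forall>i. A $ i $ i > 0}"

lemma lower_part_LT: "lower_part A \<in> LT"
  by (auto simp: lower_part_def LT_def)

lemma lower_part_eq: "A \<in> LT \<Longrightarrow> lower_part A = A"
  by (auto simp: lower_part_def LT_def vec_eq_iff not_le)

lemma upper_part_eq_0: "A \<in> LT \<Longrightarrow> upper_part A = 0"
  by (auto simp: upper_part_def LT_def vec_eq_iff)

lemma upper_part_0: "upper_part 0 = 0"
  by (simp add: upper_part_def vec_eq_iff)

lemma lower_upper_part: "lower_part A + upper_part A = A"
  by (auto simp: lower_part_def upper_part_def vec_eq_iff)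

lemma lower_part_LTPos: "A \<in> diag_pos \<Longrightarrow> lower_part A \<in> LTPos"
  using lower_part_LT[of A] by (simp add: diag_pos_def LTPos_def lower_part_def)

lemma LTPos_diag_pos: "L \<in> LTPos \<Longrightarrow> L \<in> diag_pos"
  by (simp add: diag_pos_def LTPos_def)

lemma diag_pos_LT: "diag_pos \<inter> LT \<subseteq> LTPos"
  by (auto simp: diag_pos_def LTPos_def)

lemma open_diag_pos: "open (diag_pos :: 'n::finite sqmat set)"
proof -
  have "diag_pos = (\<Inter>i\<in>UNIV. {A :: 'n sqmat. 0 < A $ i $ i})"
    by (auto simp: diag_pos_def)
  also have "open \<dots>"
    by (intro open_INT finite ballI open_Collect_less continuous_intros)
  finally show ?thesis .
qed

lemma bounded_linear_lower_part: "bounded_linear lower_part"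
  unfolding linear_conv_bounded_linear[symmetric]
  by (rule linearI) (auto simp: lower_part_def vec_eq_iff)

lemma bounded_linear_upper_part: "bounded_linear upper_part"
  unfolding linear_conv_bounded_linear[symmetric]
  by (rule linearI) (auto simp: upper_part_def vec_eq_iff)

lemma bounded_linear_transpose: "bounded_linear (transpose :: real^'m^'n \<Rightarrow> real^'n^'m)"
  unfolding linear_conv_bounded_linear[symmetric]
  by (rule linearI) (simp_all add: transpose_add transpose_scalar)

text \<open>Comparing mirrored entries separates symmetric from skew parts, and above the diagonal
  the skew part shows \<open>upper_part\<close> itself.\<close>

lemma symmetric_skew_split:
  assumes Q: "Q \<in> Sym" "Q' \<in> Sym"
    and eq: "Q + (upper_part A - transpose (upper_part A)) = Q' + (upper_part B - transpose (upper_part B))"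
  shows "Q = Q'" "upper_part A = upper_part B"
proof -
  have sym: "Q $ i $ j = Q $ j $ i" "Q' $ i $ j = Q' $ j $ i" for i j
    using Q by (simp_all add: Sym_def transpose_def vec_eq_iff)
  have entry: "Q $ i $ j + (upper_part A $ i $ j - upper_part A $ j $ i)
      = Q' $ i $ j + (upper_part B $ i $ j - upper_part B $ j $ i)" for i j
    using arg_cong[OF eq, of "\<lambda>M. M $ i $ j"] by (simp add: transpose_def)
  have QQ: "Q $ i $ j = Q' $ i $ j" for i j
    using entry[of i j] entry[of j i] sym[of i j] by linarith
  then show "Q = Q'" by (simp add: vec_eq_iff)
  have "upper_part A $ i $ j = upper_part B $ i $ j" for i j
    using entry[of i j] QQ[of i j] by (auto simp: upper_part_def split: if_splits dest: less_asym)
  then show "upper_part A = upper_part B" by (simp add: vec_eq_iff)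
qed

lemma gram_ext_LT: "L \<in> LT \<Longrightarrow> gram_ext L = L ** transpose L"
  by (simp add: gram_ext_def lower_part_eq upper_part_eq_0) (simp add: transpose_def vec_eq_iff)

lemma inj_on_gram_ext: "inj_on gram_ext (diag_pos :: 'n::{finite,linorder} sqmat set)"
proof (rule inj_onI)
  fix A B :: "'n sqmat"
  assume A: "A \<in> diag_pos" and B: "B \<in> diag_pos" and eq: "gram_ext A = gram_ext B"
  note split = symmetric_skew_split[OF gram_Sym gram_Sym eq[unfolded gram_ext_def]]
  have "lower_part A = lower_part B"
    by (rule Cholesky_unique[OF lower_part_LTPos[OF A] lower_part_LTPos[OF B] split(1)])
  then show "A = B" by (metis split(2) lower_upper_part)
qed

lemma has_derivative_gram_ext:
  "(gram_ext has_derivative (\<lambda>X. (lower_part X ** transpose (lower_part A) + lower_part A ** transpose (lower_part X))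
     + (upper_part X - transpose (upper_part X)))) (at A)"
proof -
  note lin = bounded_linear_imp_has_derivative
  have "((\<lambda>A. lower_part A ** transpose (lower_part A)) has_derivative
      (\<lambda>X. lower_part A ** transpose (lower_part X) + lower_part X ** transpose (lower_part A))) (at A)"
    by (rule matmul.FDERIV[OF lin[OF bounded_linear_lower_part]
      lin[OF bounded_linear_compose[OF bounded_linear_transpose bounded_linear_lower_part]]])
  moreover have "((\<lambda>A. upper_part A - transpose (upper_part A)) has_derivative
      (\<lambda>X. upper_part X - transpose (upper_part X))) (at A)"
    by (rule has_derivative_diff[OF lin[OF bounded_linear_upper_part]
      lin[OF bounded_linear_compose[OF bounded_linear_transpose bounded_linear_upper_part]]])
  ultimately have "((\<lambda>A. lower_part A ** transpose (lower_part A) + (upper_part A - transpose (upper_part A)))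
    has_derivative (\<lambda>X. (lower_part A ** transpose (lower_part X) + lower_part X ** transpose (lower_part A))
     + (upper_part X - transpose (upper_part X)))) (at A)"
    by (rule has_derivative_add)
  then show ?thesis
    unfolding gram_ext_def[abs_def] by (simp only: add.commute[of "lower_part A ** _"])
qed

lemma continuous_on_gram_ext: "continuous_on U gram_ext"
  by (rule has_derivative_continuous_on[OF has_derivative_at_withinI[OF has_derivative_gram_ext]])

lemma open_gram_ext_image: "open (gram_ext ` diag_pos)"
  by (rule invariance_of_domain[OF continuous_on_gram_ext open_diag_pos inj_on_gram_ext])

lemma gram_ext_Chol: "S \<in> SymPos \<Longrightarrow> gram_ext (Chol S) = S"
  by (simp add: gram_ext_LT LTPos_LT Chol_LTPos Chol_gram)

lemma gram_derivative_Sym: "X ** transpose L + L ** transpose X \<in> Sym"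
  by (simp add: Sym_def transpose_add matrix_transpose_mul add.commute)

text \<open>A symmetric value has zero skew part, so it is the Gram matrix of a member of
  \<open>LTPos\<close>. Together with \<open>open_gram_ext_image\<close> this makes
  \<open>SymPos\<close> relatively open in \<open>Sym\<close>.\<close>

lemma gram_ext_image_Sym: "gram_ext ` diag_pos \<inter> Sym \<subseteq> (SymPos :: 'n::{finite,linorder} sqmat set)"
proof
  fix S :: "'n sqmat" assume "S \<in> gram_ext ` diag_pos \<inter> Sym"
  then obtain A where A: "A \<in> diag_pos" "S = gram_ext A" and S: "S \<in> Sym" by auto
  have "lower_part A ** transpose (lower_part A) + (upper_part A - transpose (upper_part A))
      = S + (upper_part 0 - transpose (upper_part 0))"
    using A(2) by (simp add: gram_ext_def upper_part_def transpose_def vec_eq_iff)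
  from symmetric_skew_split(1)[OF gram_Sym S this] show "S \<in> SymPos"
    using LTPos_gram_SymPos[OF lower_part_LTPos[OF A(1)]] by simp
qed

text \<open>The inverse function theorem applies to \<open>gram_ext\<close>, whose local inverse
  restricts to \<open>Chol\<close> on \<open>SymPos\<close>; the equation is the linearization of
  \<open>Chol S ** transpose (Chol S) = S\<close>.\<close>

lemma frechet_derivative_Chol:
  fixes S V :: "'n::{finite,linorder} sqmat"
  assumes S: "S \<in> SymPos" and V: "V \<in> Sym"
  defines "X \<equiv> frechet_derivative Chol (at S within SymPos) V"
  shows "X \<in> LT" "X ** transpose (Chol S) + Chol S ** transpose X = V"
proof -
  let ?L = "Chol S"
  let ?f' = "\<lambda>X. (lower_part X ** transpose (lower_part ?L) + lower_part ?L ** transpose (lower_part X))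
     + (upper_part X - transpose (upper_part X))"
  note L = Chol_LTPos[OF S]
  note lowL = lower_part_eq[OF LTPos_LT[OF L]]
  note split = symmetric_skew_split[OF gram_derivative_Sym[of _ ?L]]
  have lin: "linear ?f'"
    using has_derivative_gram_ext by (rule has_derivative_linear)
  have "inj ?f'"
  proof (rule linear_injective_0[OF lin, THEN iffD2], intro allI impI)
    fix X assume "?f' X = 0"
    \<comment> \<open>Zero is written with a vanishing skew part to match
      \<open>symmetric_skew_split\<close>; the symmetric part then forces
      \<open>lower_part X = 0\<close>, the skew part \<open>upper_part X = 0\<close>.\<close>
    then have "?f' X = 0 + (upper_part 0 - transpose (upper_part 0))"
      by (simp add: upper_part_def transpose_def vec_eq_iff)
    note * = split[OF subspace_0[OF subspace_Sym] this[unfolded lowL]]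
    have "lower_part X = 0"
      by (rule gram_derivative_inj[OF L lower_part_LT *(1)])
    then show "X = 0"
      using *(2) lower_upper_part[of X] by (simp add: upper_part_0)
  qed
  then obtain g' where g': "\<And>X. ?f' (g' X) = X"
    using linear_injective_isomorphism[OF lin] by blast
  let ?g = "inv_into diag_pos gram_ext"
  have inv: "?g (gram_ext A) = A" if "A \<in> diag_pos" for A :: "'n sqmat"
    by (rule inv_into_f_f[OF inj_on_gram_ext that])
  have "?f' \<circ> g' = id" by (rule ext) (simp only: g' o_apply id_apply)
  note inverse = has_derivative_inverse_strong[OF open_diag_pos LTPos_diag_pos[OF L]
      continuous_on_gram_ext _ has_derivative_gram_ext this]
  have "(?g has_derivative g') (at (gram_ext ?L))"
    by (rule inverse) (rule inv)
  then have "(?g has_derivative g') (at S within SymPos)"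
    unfolding gram_ext_Chol[OF S] by (rule has_derivative_at_withinI)
  then have "(Chol has_derivative g') (at S within SymPos)"
    by (rule has_derivative_transform[OF S, rotated])
       (metis inv gram_ext_Chol Chol_LTPos LTPos_diag_pos)
  moreover have "S \<in> gram_ext ` diag_pos"
    using gram_ext_Chol[OF S] LTPos_diag_pos[OF L] by (rule image_eqI[OF sym])
  moreover have "S \<in> Sym" using S by (simp add: SymPos_def)
  ultimately have X: "X = g' V"
    unfolding X_def
    by (intro frechet_derivative_rel_open[OF _ open_gram_ext_image _ gram_ext_image_Sym subspace_Sym _ V])
  \<comment> \<open>As \<open>V\<close> is symmetric, its preimage has no strictly upper
    part.\<close>
  have "?f' X = V + (upper_part 0 - transpose (upper_part 0))"
    unfolding X g' by (simp add: upper_part_def transpose_def vec_eq_iff)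
  note * = split[OF V this[unfolded lowL]]
  have "X = lower_part X"
    using *(2) lower_upper_part[of X] by (simp add: upper_part_0)
  with lower_part_LT[of X] *(1) show "X \<in> LT" "X ** transpose ?L + ?L ** transpose X = V"
    by simp_all
qed

lemma frechet_derivative_left_mult:
  assumes "L \<in> LTPos" "X \<in> LT"
  shows "frechet_derivative (\<lambda>M. K ** M) (at L within LTPos) X = K ** X"
  by (rule frechet_derivative_rel_open[OF
        bounded_linear_imp_has_derivative[OF matmul.bounded_linear_right]
        open_diag_pos LTPos_diag_pos[OF assms(1)] diag_pos_LT subspace_LT
        LTPos_LT[OF assms(1)] assms(2)])

text \<open>Both sides are lower triangular solutions of the same linearized equation at
  \<open>K ** Chol S\<close>, so \<open>gram_derivative_inj\<close> identifies them.\<close>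

lemma frechet_derivative_Chol_congruence:
  assumes S: "S \<in> SymPos" and K: "K \<in> LTPos" and V: "V \<in> Sym"
  shows "frechet_derivative Chol (at (K ** S ** transpose K) within SymPos) (K ** V ** transpose K)
    = K ** frechet_derivative Chol (at S within SymPos) V"
proof -
  let ?S = "K ** S ** transpose K"
  let ?X = "frechet_derivative Chol (at S within SymPos) V"
  let ?Y = "frechet_derivative Chol (at ?S within SymPos) (K ** V ** transpose K)"
  note X = frechet_derivative_Chol[OF S V]
  have S': "?S \<in> SymPos" by (rule congruence_SymPos[OF S LTPos_invertible[OF K]])
  note Y = frechet_derivative_Chol[OF S' congruence_Sym[OF V], unfolded Chol_congruence[OF S K]]
  have "(K ** ?X) ** transpose (K ** Chol S) + (K ** Chol S) ** transpose (K ** ?X)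
      = K ** (?X ** transpose (Chol S) + Chol S ** transpose ?X) ** transpose K"
    by (simp only: matmul.add_left matmul.add_right matrix_transpose_mul matrix_mul_assoc)
  also have "\<dots> = ?Y ** transpose (K ** Chol S) + (K ** Chol S) ** transpose ?Y"
    by (simp only: X(2) Y(2))
  finally have eq: "(?Y - K ** ?X) ** transpose (K ** Chol S) + (K ** Chol S) ** transpose (?Y - K ** ?X) = 0"
    by (simp only: matmul.diff_left matmul.diff_right transpose_diff) (simp add: algebra_simps)
  have "?Y - K ** ?X \<in> LT"
    by (intro subspace_diff[OF subspace_LT] Y(1) LT_mult LTPos_LT[OF K] X(1))
  from gram_derivative_inj[OF LTPos_mult[OF K Chol_LTPos[OF S]] this eq] show ?thesis by simp
qed


section \<open>Invariant metrics\<close>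

lemma lie_cholesky_imp_invariant:
  fixes g :: "'n::{finite,linorder} sqmat \<Rightarrow> 'n sqmat \<Rightarrow> 'n sqmat \<Rightarrow> real"
  assumes "lie_cholesky_metric g"
  shows "LTPos_invariant g"
  unfolding LTPos_invariant_def
proof (intro ballI)
  fix K S V W :: "'n sqmat"
  assume K: "K \<in> LTPos" and S: "S \<in> SymPos" and V: "V \<in> Sym" and W: "W \<in> Sym"
  obtain h where h: "left_invariant h"
    and g: "\<And>S V W. S \<in> SymPos \<Longrightarrow> V \<in> Sym \<Longrightarrow> W \<in> Sym \<Longrightarrow> g S V W = pullback SymPos Chol h S V W"
    using assms unfolding lie_cholesky_metric_def by auto
  note L = Chol_LTPos[OF S]
  note X = frechet_derivative_Chol(1)[OF S V] and Y = frechet_derivative_Chol(1)[OF S W]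
  have inv: "h (K ** L) (K ** X) (K ** Y) = h L X Y" if "L \<in> LTPos" "X \<in> LT" "Y \<in> LT" for L X Y
    using h K that unfolding left_invariant_def pullback_def
    by (metis frechet_derivative_left_mult)
  have "K ** S ** transpose K \<in> SymPos"
    by (rule congruence_SymPos[OF S LTPos_invertible[OF K]])
  then have "g (K ** S ** transpose K) (K ** V ** transpose K) (K ** W ** transpose K)
    = pullback SymPos Chol h (K ** S ** transpose K) (K ** V ** transpose K) (K ** W ** transpose K)"
    by (intro g congruence_Sym V W)
  also have "\<dots> = pullback SymPos Chol h S V W"
    by (simp only: pullback_def Chol_congruence[OF S K] frechet_derivative_Chol_congruence[OF S K V]
        frechet_derivative_Chol_congruence[OF S K W] inv[OF L X Y])
  also have "\<dots> = g S V W" by (rule g[OF S V W, symmetric])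
  finally show "g (K ** S ** transpose K) (K ** V ** transpose K) (K ** W ** transpose K) = g S V W" .
qed

section \<open>An invariant metric as the pullback of a left-invariant one\<close>

context
  fixes g :: "'n::{finite,linorder} sqmat \<Rightarrow> 'n sqmat \<Rightarrow> 'n sqmat \<Rightarrow> real"
  assumes metric: "riemannian_metric Sym SymPos g"
begin

text \<open>On \<open>LT\<close> this is \<open>g\<close> at the identity pulled back along the
  derivative of \<open>L ** transpose L\<close>. Taking all matrices as arguments makes it a bounded
  bilinear map on a Euclidean space.\<close>

definition symmetrized_form :: "'n sqmat \<Rightarrow> 'n sqmat \<Rightarrow> real"
  where "symmetrized_form X Y = g (mat 1) (X + transpose X) (Y + transpose Y)"

definition lifted_metric :: "'n sqmat \<Rightarrow> 'n sqmat \<Rightarrow> 'n sqmat \<Rightarrow> real"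
  where "lifted_metric L X Y = symmetrized_form (matrix_inv L ** X) (matrix_inv L ** Y)"

lemma
  assumes "U \<in> Sym" "V \<in> Sym" "W \<in> Sym"
  shows metric_add: "g (mat 1) (U + V) W = g (mat 1) U W + g (mat 1) V W"
    and metric_scale: "g (mat 1) (c *\<^sub>R V) W = c * g (mat 1) V W"
    and metric_commute: "g (mat 1) V W = g (mat 1) W V"
    and metric_pos: "V \<noteq> 0 \<Longrightarrow> g (mat 1) V V > 0"
  using metric assms mat_1_SymPos unfolding riemannian_metric_def by auto

lemma symmetrized_form_commute: "symmetrized_form X Y = symmetrized_form Y X"
  unfolding symmetrized_form_def by (rule metric_commute) (rule add_transpose_Sym)+

lemma symmetrized_form_add:
  "symmetrized_form (X + X') Y = symmetrized_form X Y + symmetrized_form X' Y"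
proof -
  have "X + X' + transpose (X + X') = (X + transpose X) + (X' + transpose X')"
    by (simp add: transpose_add)
  then show ?thesis
    unfolding symmetrized_form_def
    by (simp only: metric_add[OF add_transpose_Sym add_transpose_Sym add_transpose_Sym])
qed

lemma symmetrized_form_scale: "symmetrized_form (c *\<^sub>R X) Y = c * symmetrized_form X Y"
proof -
  have "c *\<^sub>R X + transpose (c *\<^sub>R X) = c *\<^sub>R (X + transpose X)"
    by (simp add: transpose_scalar scaleR_add_right)
  then show ?thesis
    unfolding symmetrized_form_def
    by (simp only: metric_scale[OF add_transpose_Sym add_transpose_Sym add_transpose_Sym])
qed

lemma bounded_bilinear_symmetrized_form: "bounded_bilinear symmetrized_form"
  unfolding bilinear_conv_bounded_bilinear[symmetric] bilinear_def
  by (auto intro!: linearI simp: symmetrized_form_add symmetrized_form_scale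
      symmetrized_form_commute[of _ "_ + _"] symmetrized_form_commute[of _ "_ *\<^sub>R _"])
     (simp_all add: symmetrized_form_commute)

lemma riemannian_lifted_metric: "riemannian_metric LT LTPos lifted_metric"
  unfolding riemannian_metric_def
proof (intro conjI ballI allI impI)
  fix L X Y Z :: "'n sqmat" and c :: real
  show "lifted_metric L (X + Y) Z = lifted_metric L X Z + lifted_metric L Y Z"
    by (simp only: lifted_metric_def matmul.add_right symmetrized_form_add)
  show "lifted_metric L (c *\<^sub>R X) Z = c * lifted_metric L X Z"
    by (simp only: lifted_metric_def matmul.scaleR_right symmetrized_form_scale)
  show "lifted_metric L X Y = lifted_metric L Y X"
    by (simp only: lifted_metric_def symmetrized_form_commute)
next
  fix L X :: "'n sqmat" assume L: "L \<in> LTPos" and X: "X \<in> LT" "X \<noteq> 0"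
  have "matrix_inv L ** X \<in> LT"
    by (intro LT_mult LTPos_LT LTPos_inv L X)
  moreover have "L ** (matrix_inv L ** X) = X"
    by (simp only: matrix_mul_assoc matrix_inv_inverse[OF LTPos_invertible[OF L]] matrix_mul_lid)
  then have "matrix_inv L ** X \<noteq> 0" using X(2) matmul.zero_right[of L] by metis
  \<comment> \<open>Definiteness: a nonzero lower triangular matrix is not skew, so its
    symmetrization is nonzero.\<close>
  ultimately have "matrix_inv L ** X + transpose (matrix_inv L ** X) \<noteq> 0"
    using LT_skew_eq_0[of "matrix_inv L ** X"] by blast
  then show "lifted_metric L X X > 0"
    unfolding lifted_metric_def symmetrized_form_def
    by (rule metric_pos[OF add_transpose_Sym add_transpose_Sym add_transpose_Sym])
next
  fix X Y :: "'n sqmat"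
  have "LTPos \<subseteq> {A :: 'n sqmat. invertible A}" using LTPos_invertible by blast
  note inv = Ck_on_matrix_inv[OF this]
  show "smooth_on LT LTPos (\<lambda>L. lifted_metric L X Y)"
    unfolding smooth_on_def lifted_metric_def
    by (intro allI Ck_on_bounded_bilinear[OF bounded_bilinear_symmetrized_form]
        Ck_on_bounded_bilinear[OF bounded_bilinear_matrix_mult] Ck_on_const inv)
qed

lemma left_invariant_lifted_metric: "left_invariant lifted_metric"
  unfolding left_invariant_def
proof (intro ballI)
  fix K L X Y :: "'n sqmat"
  assume K: "K \<in> LTPos" and L: "L \<in> LTPos" and X: "X \<in> LT" and Y: "Y \<in> LT"
  note KL = LTPos_mult[OF K L]
  have cancel: "matrix_inv (K ** L) ** (K ** Z) = matrix_inv L ** Z" for Z :: "'n sqmat"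
  proof -
    \<comment> \<open>Inserting \<open>L ** matrix_inv L\<close> produces the factor
      \<open>K ** L\<close>, which cancels against its inverse.\<close>
    have "matrix_inv (K ** L) ** (K ** Z) = matrix_inv (K ** L) ** (K ** ((L ** matrix_inv L) ** Z))"
      by (simp only: matrix_inv_inverse[OF LTPos_invertible[OF L]] matrix_mul_lid)
    also have "\<dots> = (matrix_inv (K ** L) ** (K ** L)) ** (matrix_inv L ** Z)"
      by (simp only: matrix_mul_assoc)
    also have "\<dots> = matrix_inv L ** Z"
      by (simp only: matrix_inv_inverse[OF LTPos_invertible[OF KL]] matrix_mul_lid)
    finally show ?thesis .
  qed
  show "pullback LTPos (\<lambda>M. K ** M) lifted_metric L X Y = lifted_metric L X Y"
    by (simp only: pullback_def frechet_derivative_left_mult[OF L X] frechet_derivative_left_mult[OF L Y]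
        lifted_metric_def cancel)
qed

text \<open>Congruence by the inverse of \<open>Chol S\<close> sends \<open>S\<close> to the
  identity and each tangent vector to the symmetrization inside \<open>lifted_metric\<close>;
  invariance of \<open>g\<close> under it gives the equality.\<close>

lemma pullback_lifted_metric:
  assumes inv: "LTPos_invariant g" and S: "S \<in> SymPos" and V: "V \<in> Sym" and W: "W \<in> Sym"
  shows "pullback SymPos Chol lifted_metric S V W = g S V W"
proof -
  let ?L = "Chol S"
  let ?N = "matrix_inv ?L"
  note L = Chol_LTPos[OF S]
  have eq: "?N ** frechet_derivative Chol (at S within SymPos) Z
      + transpose (?N ** frechet_derivative Chol (at S within SymPos) Z) = ?N ** Z ** transpose ?N"
    if "Z \<in> Sym" for Z
    by (simp only: gram_derivative_inv[OF L, symmetric] frechet_derivative_Chol(2)[OF S that])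
  have "mat 1 = (?N ** ?L) ** transpose (?N ** ?L)"
    by (simp only: matrix_inv_inverse[OF LTPos_invertible[OF L]] transpose_mat matrix_mul_lid)
  also have "\<dots> = ?N ** (?L ** transpose ?L) ** transpose ?N"
    by (simp only: matrix_transpose_mul matrix_mul_assoc)
  finally have "mat 1 = ?N ** S ** transpose ?N" by (simp only: Chol_gram[OF S])
  then have "pullback SymPos Chol lifted_metric S V W
    = g (?N ** S ** transpose ?N) (?N ** V ** transpose ?N) (?N ** W ** transpose ?N)"
    by (simp only: pullback_def lifted_metric_def symmetrized_form_def eq[OF V] eq[OF W])
  also have "\<dots> = g S V W"
    using inv LTPos_inv[OF L] S V W unfolding LTPos_invariant_def by simp
  finally show ?thesis .
qed

end

theorem theorem3p3:
  fixes g :: "'n::{finite,linorder} sqmat \<Rightarrow> 'n sqmat \<Rightarrow> 'n sqmat \<Rightarrow> real"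
  assumes "riemannian_metric Sym SymPos g"
  shows "lie_cholesky_metric g \<longleftrightarrow> LTPos_invariant g"
proof
  assume "LTPos_invariant g"
  with riemannian_lifted_metric[OF assms] left_invariant_lifted_metric[OF assms]
    pullback_lifted_metric[OF assms]
  show "lie_cholesky_metric g"
    unfolding lie_cholesky_metric_def by (intro exI[of _ "lifted_metric g"] conjI ballI) simp_all
qed (rule lie_cholesky_imp_invariant)

end
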